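(* Let $N\geq 2$, let $\Omega$ be a bounded smooth domain in $\mathbb{R}^N$, and let $\ell\geq 2$. Then, for all sufficiently small $r>0$, $$\mathrm{cat}\big(F_{\ell,r}(\Omega)\hookrightarrow F_\ell(\Omega_r^+)\big)\geq\ell.$$ Furthermore, if $\Omega$ is convex, then for all sufficiently small $r>0$, $$\mathrm{cat}\big(F_{\ell,r}(\Omega)\hookrightarrow F_\ell(\Omega)\big)=\ell.$$
   Context: For $\Theta\subset\mathbb{R}^N$, $r\geq 0$ and $\ell\geq 2$, $$F_{\ell,r}(\Theta):=\{(\xi_1,\ldots,\xi_\ell)\in\Theta^\ell:\mathrm{dist}(\xi_i,\mathbb{R}^N\smallsetminus\Theta)>r\text{ for all }i,\text{ and }|\xi_i-\xi_j|>2r\text{ if }i\neq j\}$$ with the subspace topology of $\Theta^\ell$; $F_\ell(\Theta):=F_{\ell,0}(\Theta)$ is (for $\Theta$ open) the ordered configuration space of $\ell$ pairwise distinct points in $\Theta$. Moreover $\Theta_r^+:=\{x\in\mathbb{R}^N:\mathrm{dist}(x,\Theta)<r\}$. For a topological space $X$ and a subset $A\subset X$, $\mathrm{cat}(A\hookrightarrow X)$ is the Lusternik-Schnirelman category of $A$ in $X$: the smallest number of subsets of $A$ that cover $A$ and such that each of them is open in $A$ and contractible in $X$ (i.e. its inclusion into $X$ is homotopic to a constant map). *)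

theory Defs
  imports "HOL-Analysis.Analysis" "HOL-Library.Extended_Nat"
begin

fun C_k_on :: "nat \<Rightarrow> 'a::euclidean_space set \<Rightarrow> ('a \<Rightarrow> real) \<Rightarrow> bool" where
  "C_k_on 0 S f \<longleftrightarrow> continuous_on S f"
| "C_k_on (Suc k) S f \<longleftrightarrow>
     (\<forall>x\<in>S. f differentiable (at x)) \<and>
     (\<forall>b\<in>Basis. C_k_on k S (\<lambda>x. frechet_derivative f (at x) b))"

definition C_infinity_on :: "'a::euclidean_space set \<Rightarrow> ('a \<Rightarrow> real) \<Rightarrow> bool" where
  "C_infinity_on S f \<longleftrightarrow> (\<forall>k. C_k_on k S f)"

text \<open>
  Near every boundary point, after relabelling and possibly reversing a coordinate axis,
  the domain is the strict epigraph of a smooth function \<open>\<gamma>\<close> of the other \<open>N - 1\<close>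
  coordinates.  Here \<open>\<real>\<^sup>N\<^sup>-\<^sup>1\<close> is the hyperplane \<open>x $ i = 0\<close>: \<open>\<gamma>\<close> is only
  evaluated there.
\<close>
definition smooth_boundary :: "(real^'n) set \<Rightarrow> bool" where
  "smooth_boundary \<Omega> \<longleftrightarrow>
     (\<forall>p\<in>frontier \<Omega>. \<exists>\<rho>>0. \<exists>i. \<exists>\<sigma>\<in>{-1, 1}. \<exists>\<gamma> :: real^'n \<Rightarrow> real.
        C_infinity_on UNIV \<gamma> \<and>
        \<Omega> \<inter> ball p \<rho> =
          {x \<in> ball p \<rho>. \<sigma> * x $ i > \<gamma> (\<chi> j. if j = i then 0 else x $ j)})"

definition bounded_smooth_domain :: "(real^'n) set \<Rightarrow> bool" where
  "bounded_smooth_domain \<Omega> \<longleftrightarrow>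
     \<Omega> \<noteq> {} \<and> open \<Omega> \<and> connected \<Omega> \<and> bounded \<Omega> \<and> smooth_boundary \<Omega>"

text \<open>
  The number \<open>\<ell>\<close> of points is \<open>CARD('l)\<close>.  The convention \<open>dist(x, {}) = \<infinity>\<close> is made
  explicit in the next two definitions because \<^const>\<open>infdist\<close> is \<open>0\<close> on the empty set.
\<close>
definition config_space :: "real \<Rightarrow> (real^'n) set \<Rightarrow> (real^'n^'l) set" where
  "config_space r \<Theta> =
     {\<xi>. (\<forall>i. \<xi> $ i \<in> \<Theta> \<and> (- \<Theta> = {} \<or> infdist (\<xi> $ i) (- \<Theta>) > r)) \<and>
         (\<forall>i j. i \<noteq> j \<longrightarrow> norm (\<xi> $ i - \<xi> $ j) > 2 * r)}"

definition outer_nbhd :: "real \<Rightarrow> (real^'n) set \<Rightarrow> (real^'n) set" where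
  "outer_nbhd r \<Theta> = {x. \<Theta> \<noteq> {} \<and> infdist x \<Theta> < r}"

definition contractible_in :: "'a topology \<Rightarrow> 'a set \<Rightarrow> bool" where
  "contractible_in X U \<longleftrightarrow>
     (\<exists>a. homotopic_with (\<lambda>_. True) (subtopology X U) X id (\<lambda>_. a))"

text \<open>
  \<open>LS_cat X A\<close> is the category of \<open>A\<close> in \<open>X\<close>, for \<open>A \<subseteq> topspace X\<close>; it is \<open>\<infinity>\<close> (the infimum
  of the empty set) if no finite cover of the required kind exists.
\<close>
definition LS_cat :: "'a topology \<Rightarrow> 'a set \<Rightarrow> enat" where
  "LS_cat X A =
     Inf {enat (card \<U>) | \<U>. finite \<U> \<and> \<Union>\<U> = A \<and>
            (\<forall>U\<in>\<U>. openin (subtopology X A) U \<and> contractible_in X U)}"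

end

theory Submission
  imports Defs
begin

text \<open>
  Upper bound. Sort the configurations by the number of distinct projections of their points along
  a coordinate axis. The configurations with a given number split into disjoint pieces, one for each
  partition of the points into vertical lines together with their order on each line. Each piece has
  an open neighbourhood that contracts along straight lines to a vertical stack of points, and all
  stacks can be moved to one fixed stack along a second axis. Neighbourhoods belonging to the same
  number of projections are disjoint, so their union is still contractible in the whole space.

  Lower bound. Put one point at \<open>c\<close> and let the others run over concentric spheres around it;
  this maps a product of \<open>\<ell> - 1\<close> spheres into the small configuration space, and the direction
  from the central point to the \<open>i\<close>-th one recovers the \<open>i\<close>-th factor. If \<open>\<ell> - 1\<close> sets as in the
  definition of the category covered it, the product of spheres would be covered by \<open>\<ell> - 1\<close> open
  sets such that the \<open>i\<close>-th projection is null-homotopic on the \<open>i\<close>-th set. Gluing these homotopies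
  radially gives a self-map of Euclidean space that is the identity outside a bounded set but
  misses a point, which contradicts Brouwer's theorem.
\<close>

text \<open>A point of an open set has positive distance to a nonempty complement, so at radius 0
  only membership and distinctness remain.\<close>

lemma config_space_0_open:
  assumes "open \<Theta>"
  shows "config_space 0 \<Theta> = {\<xi> :: real^'n^'l. (\<forall>i. \<xi> $ i \<in> \<Theta>) \<and> (\<forall>i j. i \<noteq> j \<longrightarrow> \<xi> $ i \<noteq> \<xi> $ j)}"
proof -
  have "infdist x (- \<Theta>) > 0" if "x \<in> \<Theta>" "- \<Theta> \<noteq> {}" for x
    using that assms in_closed_iff_infdist_zero[of "- \<Theta>" x] infdist_nonneg[of x "- \<Theta>"]
    by (force simp: closed_def)
  then show ?thesis
    unfolding config_space_def by fastforce
qed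

section \<open>The upper bound\<close>

text \<open>Sending an \<open>R\<close>-class to the \<open>S\<close>-class around it is surjective
  on quotients; equal finite cardinalities make it injective, so no two \<open>R\<close>-classes
  merge.\<close>

lemma equiv_refines_card_eq:
  assumes "equiv A R" "equiv A S" "R \<subseteq> S" "finite A" "card (A // R) = card (A // S)"
  shows "R = S"
proof -
  have fin: "finite (A // R)" by (rule finite_quotient[OF assms(4) equiv_type[OF assms(1)]])
  have "(\<lambda>X. S `` X) ` (A // R) = A // S"
    by (rule refines_equiv_image_eq[OF assms(3,1,2)])
  then have inj: "inj_on (\<lambda>X. S `` X) (A // R)"
    using fin assms(5) by (intro eq_card_imp_inj_on) simp_all
  have "(a, b) \<in> R" if ab: "(a, b) \<in> S" for a b
  proof -
    have A: "a \<in> A" "b \<in> A" using ab equiv_type[OF assms(2)] by auto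
    have cls: "S `` (R `` {x}) = S `` {x}" for x
      by (rule refines_equiv_class_eq2[OF assms(3,1,2)])
    have "S `` (R `` {a}) = S `` (R `` {b})"
      unfolding cls by (rule equiv_class_eq[OF assms(2) ab])
    then have "R `` {a} = R `` {b}"
      by (rule inj_onD[OF inj, OF _ quotientI[OF A(1)] quotientI[OF A(2)]])
    then show ?thesis by (rule eq_equiv_class[OF _ assms(1) A(2)])
  qed
  then have "S \<subseteq> R" by (rule subrelI)
  then show ?thesis by (rule subset_antisym[OF assms(3)])
qed

lemma open_Collect_all_finite:
  fixes P :: "'i::finite \<Rightarrow> 'a::topological_space \<Rightarrow> bool"
  assumes "\<And>i. open {x. P i x}"
  shows "open {x. \<forall>i. P i x}"
proof -
  have "{x. \<forall>i. P i x} = (\<Inter>i. {x. P i x})" by blast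
  also have "open \<dots>" by (rule open_INT) (simp_all add: assms)
  finally show ?thesis .
qed

text \<open>Ranks come from sorting by \<open>f\<close>. Ties are broken arbitrarily, hence the weak
  inequality: points on different vertical lines may have equal heights.\<close>

lemma ex_monotone_enumeration:
  fixes f :: "'l::finite \<Rightarrow> 'a::linorder"
  shows "\<exists>\<sigma>. bij_betw \<sigma> UNIV {0..<CARD('l)} \<and> (\<forall>i j. \<sigma> i < \<sigma> j \<longrightarrow> f i \<le> f j)"
proof -
  obtain xs :: "'l list" where xs: "set xs = UNIV" "distinct xs"
    using finite_distinct_list[of "UNIV :: 'l set"] by auto
  define ys where "ys = sort_key f xs"
  have ys: "set ys = UNIV" "distinct ys" "sorted (map f ys)"
    by (simp_all add: ys_def xs)
  have len: "length ys = CARD('l)" using distinct_card[OF ys(2)] by (simp add: ys(1))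
  have bij: "bij_betw ((!) ys) {0..<CARD('l)} UNIV"
    by (rule bij_betw_nth[OF ys(2)]) (simp_all add: ys(1) lessThan_atLeast0 flip: len)
  define \<sigma> where "\<sigma> = inv_into {0..<CARD('l)} ((!) ys)"
  have "bij_betw \<sigma> UNIV {0..<CARD('l)}" unfolding \<sigma>_def by (rule bij_betw_inv_into[OF bij])
  moreover have "f i \<le> f j" if "\<sigma> i < \<sigma> j" for i j
  proof -
    have nth: "ys ! \<sigma> k = k" for k
      unfolding \<sigma>_def by (rule f_inv_into_f) (simp add: bij_betw_imp_surj_on[OF bij])
    have "\<sigma> j < length ys"
      using bij_betwE[OF \<open>bij_betw \<sigma> UNIV _\<close>] by (simp add: len)
    then have "map f ys ! \<sigma> i \<le> map f ys ! \<sigma> j"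
      using that by (intro sorted_nth_mono[OF ys(3)]) auto
    then show ?thesis
      using that \<open>\<sigma> j < length ys\<close> by (simp add: nth)
  qed
  ultimately show ?thesis by blast
qed

section \<open>Charts of configurations grouped by vertical lines\<close>

text \<open>The orthogonal projection along axis \<open>k\<close>, kept inside
  \<open>real^'n\<close> to avoid a type of lower dimension.\<close>

definition horizontal :: "'n \<Rightarrow> real^'n \<Rightarrow> real^'n" where
  "horizontal k u = u - (u $ k) *\<^sub>R axis k 1"

text \<open>
  \<open>E\<close> is the partition into vertical lines, thickened: horizontal distances within a class only
  have to be smaller than those between classes.  Only the order that \<open>\<sigma>\<close> induces on each class
  matters.
\<close>
definition chart :: "'n \<Rightarrow> ('l \<times> 'l) set \<Rightarrow> ('l \<Rightarrow> nat) \<Rightarrow> (real^'n^'l) set" where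
  "chart k E \<sigma> = {x.
     (\<forall>i j. (i, j) \<in> E \<and> \<sigma> i < \<sigma> j \<longrightarrow> x $ i $ k < x $ j $ k) \<and>
     (\<forall>i j m n. (i, j) \<in> E \<and> (m, n) \<notin> E \<longrightarrow>
        dist (horizontal k (x $ i)) (horizontal k (x $ j)) <
        dist (horizontal k (x $ m)) (horizontal k (x $ n)))}"

lemma horizontal_eq_imp_eq:
  assumes "horizontal k u = horizontal k v" "u $ k = v $ k"
  shows "u = v"
  using assms by (simp add: horizontal_def)

lemma continuous_on_horizontal [continuous_intros]:
  "continuous_on A f \<Longrightarrow> continuous_on A (\<lambda>x. horizontal k (f x))"
  unfolding horizontal_def by (intro continuous_intros)

lemma open_chart: "open (chart k E \<sigma> :: (real^'n^'l::finite) set)"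
proof -
  have 1: "open {x :: real^'n^'l. \<forall>i j. (i, j) \<in> E \<and> \<sigma> i < \<sigma> j \<longrightarrow> x $ i $ k < x $ j $ k}"
    by (intro open_Collect_all_finite open_Collect_imp closed_Collect_const
        open_Collect_less continuous_intros)
  have 2: "open {x :: real^'n^'l. \<forall>i j m n. (i, j) \<in> E \<and> (m, n) \<notin> E \<longrightarrow>
        dist (horizontal k (x $ i)) (horizontal k (x $ j)) <
        dist (horizontal k (x $ m)) (horizontal k (x $ n))}"
    by (intro open_Collect_all_finite open_Collect_imp closed_Collect_const
        open_Collect_less continuous_intros)
  show ?thesis unfolding chart_def by (rule open_Collect_conj[OF 1 2])
qed

lemma chart_height_iff:
  assumes "x \<in> chart k E \<sigma>" "equiv UNIV E" "inj \<sigma>" "(i, j) \<in> E"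
  shows "\<sigma> i < \<sigma> j \<longleftrightarrow> x $ i $ k < x $ j $ k"
proof -
  have "(j, i) \<in> E" using assms(2,4) by (meson equivE symE)
  then have "\<sigma> i < \<sigma> j \<Longrightarrow> x $ i $ k < x $ j $ k" "\<sigma> j < \<sigma> i \<Longrightarrow> x $ j $ k < x $ i $ k"
    using assms(1,4) unfolding chart_def by auto
  moreover have "\<sigma> i = \<sigma> j \<Longrightarrow> i = j" using assms(3) by (rule injD)
  ultimately show ?thesis by (metis less_irrefl less_asym linorder_neqE_nat)
qed

text \<open>The relations are nested, so equal class numbers force \<open>E = E'\<close>. The
  heights of \<open>x\<close> then determine the order within each class, and a chart depends on
  nothing else.\<close>

lemma chart_eqI:
  fixes x :: "real^'n^'l::finite"
  assumes "equiv UNIV E" "equiv UNIV E'" "card (UNIV // E) = card (UNIV // E')"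
    and "inj \<sigma>" "inj \<sigma>'" "x \<in> chart k E \<sigma>" "x \<in> chart k E' \<sigma>'"
  shows "chart k E \<sigma> = (chart k E' \<sigma>' :: (real^'n^'l) set)"
proof -
  \<comment> \<open>both \<open>E\<close> and \<open>E'\<close> are initial segments of the pairs ordered by horizontal distance\<close>
  have "E \<subseteq> E' \<or> E' \<subseteq> E"
  proof (rule ccontr)
    assume "\<not> (E \<subseteq> E' \<or> E' \<subseteq> E)"
    then obtain i j m n where *: "(i, j) \<in> E" "(i, j) \<notin> E'" "(m, n) \<in> E'" "(m, n) \<notin> E"
      by (meson subrelI)
    let ?d = "\<lambda>i j. dist (horizontal k (x $ i)) (horizontal k (x $ j))"
    have "?d i j < ?d m n" using assms(6) * unfolding chart_def by blast
    moreover have "?d m n < ?d i j" using assms(7) * unfolding chart_def by blast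
    ultimately show False by simp
  qed
  then have "E = E'"
    using equiv_refines_card_eq[OF assms(1,2)] equiv_refines_card_eq[OF assms(2,1)] assms(3) by auto
  have "\<sigma> i < \<sigma> j \<longleftrightarrow> \<sigma>' i < \<sigma>' j" if "(i, j) \<in> E" for i j
    using chart_height_iff[OF assms(6,1,4)] chart_height_iff[OF assms(7,2,5)] that \<open>E = E'\<close> by simp
  then have "(i, j) \<in> E \<and> \<sigma> i < \<sigma> j \<longleftrightarrow> (i, j) \<in> E \<and> \<sigma>' i < \<sigma>' j" for i j by blast
  then show ?thesis using \<open>E = E'\<close> unfolding chart_def by simp
qed

text \<open>Exact vertical alignment serves as \<open>E\<close>: horizontal distances are zero
  within classes and positive between them. Distinct points on one line have distinct heights, so
  sorting by height is strict there.\<close>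

lemma ex_chart:
  fixes x :: "real^'n^'l::finite"
  assumes "\<And>i j. i \<noteq> j \<Longrightarrow> x $ i \<noteq> x $ j"
  shows "\<exists>E \<sigma>. equiv UNIV E \<and> bij_betw \<sigma> UNIV {0..<CARD('l)} \<and> x \<in> chart k E \<sigma>"
proof -
  define E where "E = {(i, j). horizontal k (x $ i) = horizontal k (x $ j)}"
  have "equiv UNIV E"
    by (rule equivI) (auto simp: E_def refl_on_def sym_def trans_def)
  obtain \<sigma> :: "'l \<Rightarrow> nat" where \<sigma>: "bij_betw \<sigma> UNIV {0..<CARD('l)}"
      "\<And>i j. \<sigma> i < \<sigma> j \<Longrightarrow> x $ i $ k \<le> x $ j $ k"
    using ex_monotone_enumeration[of "\<lambda>i. x $ i $ k"] by auto
  have "x $ i $ k < x $ j $ k" if "(i, j) \<in> E" "\<sigma> i < \<sigma> j" for i j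
  proof -
    have "x $ i \<noteq> x $ j" using assms that by force
    then have "x $ i $ k \<noteq> x $ j $ k" using that horizontal_eq_imp_eq by (auto simp: E_def)
    then show ?thesis using \<sigma>(2)[OF that(2)] by simp
  qed
  then have "x \<in> chart k E \<sigma>" by (auto simp: chart_def E_def)
  then show ?thesis using \<open>equiv UNIV E\<close> \<sigma>(1) by blast
qed

section \<open>Straight-line homotopies in a convex domain\<close>

text \<open>Convexity keeps each point in \<Omega>, so only collisions matter. They have to be
  excluded for \<open>t < 1\<close> only, where a factor \<open>1 - t\<close> can be cancelled; at
  \<open>t = 1\<close> the configuration is \<open>g x\<close>.\<close>

lemma linear_homotopy_in_config_space:
  fixes \<Omega> :: "(real^'n) set" and f g :: "'a::topological_space \<Rightarrow> real^'n^'l::finite"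
  assumes "open \<Omega>" "convex \<Omega>" "continuous_on U f" "continuous_on U g"
    and "\<And>x. x \<in> U \<Longrightarrow> f x \<in> config_space 0 \<Omega>" "\<And>x. x \<in> U \<Longrightarrow> g x \<in> config_space 0 \<Omega>"
    and distinct: "\<And>x t i j. \<lbrakk>x \<in> U; 0 \<le> t; t < 1; i \<noteq> j\<rbrakk> \<Longrightarrow>
          (1 - t) *\<^sub>R f x $ i + t *\<^sub>R g x $ i \<noteq> (1 - t) *\<^sub>R f x $ j + t *\<^sub>R g x $ j"
  shows "homotopic_with_canon (\<lambda>_. True) U (config_space 0 \<Omega>) f g"
proof (rule homotopic_with_linear[OF assms(3,4)])
  fix x assume "x \<in> U"
  have f: "\<And>i. f x $ i \<in> \<Omega>" and g: "\<And>i. g x $ i \<in> \<Omega>" 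
    using assms(5,6)[OF \<open>x \<in> U\<close>] by (auto simp: config_space_0_open[OF \<open>open \<Omega>\<close>])
  show "closed_segment (f x) (g x) \<subseteq> config_space 0 \<Omega>"
  proof
    fix y assume "y \<in> closed_segment (f x) (g x)"
    then obtain t where t: "0 \<le> t" "t \<le> 1" "y = (1 - t) *\<^sub>R f x + t *\<^sub>R g x"
      by (auto simp: closed_segment_def)
    show "y \<in> config_space 0 \<Omega>"
    proof (cases "t = 1")
      case True
      then show ?thesis using t assms(6)[OF \<open>x \<in> U\<close>] by simp
    next
      case False
      have "y $ i \<in> \<Omega>" for i
        using convexD[OF \<open>convex \<Omega>\<close> f g, of "1 - t" t] t by simp
      moreover have "y $ i \<noteq> y $ j" if "i \<noteq> j" for i j
        using distinct[OF \<open>x \<in> U\<close> t(1) _ that] t False by simp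
      ultimately show ?thesis by (simp add: config_space_0_open[OF \<open>open \<Omega>\<close>])
    qed
  qed
qed

text \<open>The target of the contractions: all points on one line, in an order compatible with the
  one a chart prescribes on each class.\<close>

definition stack :: "real^'n \<Rightarrow> real \<Rightarrow> 'n \<Rightarrow> ('l \<Rightarrow> nat) \<Rightarrow> real^'n^'l" where
  "stack c s k \<sigma> = (\<chi> i. c + (s * real (\<sigma> i)) *\<^sub>R axis k 1)"

lemma stack_nth: "stack c s k \<sigma> $ i = c + (s * real (\<sigma> i)) *\<^sub>R axis k 1"
  by (simp add: stack_def)

lemma stack_in_config_space:
  fixes c :: "real^'n" and \<sigma> :: "'l::finite \<Rightarrow> nat"
  assumes "ball c \<delta> \<subseteq> \<Omega>" "open \<Omega>" "0 < s" "s * real CARD('l) \<le> \<delta>" "bij_betw \<sigma> UNIV {0..<CARD('l)}"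
  shows "stack c s k \<sigma> \<in> config_space 0 \<Omega>"
proof -
  have "stack c s k \<sigma> $ i \<in> \<Omega>" for i
  proof -
    \<comment> \<open>Ranks stop at \<open>CARD('l) - 1\<close>, so
      \<open>s * CARD('l) \<le> \<delta>\<close> suffices for the open ball.\<close>
    have "\<sigma> i < CARD('l)" using bij_betwE[OF assms(5)] by simp
    then have "s * real (\<sigma> i) < s * real CARD('l)" using assms(3) by simp
    then have "s * real (\<sigma> i) < \<delta>" using assms(4) by linarith
    then have "dist c (stack c s k \<sigma> $ i) < \<delta>"
      using assms(3) by (simp add: stack_nth dist_norm norm_axis_1)
    then show ?thesis using assms(1) by auto
  qed
  moreover have "stack c s k \<sigma> $ i \<noteq> stack c s k \<sigma> $ j" if "i \<noteq> j" for i j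
  proof
    assume eq: "stack c s k \<sigma> $ i = stack c s k \<sigma> $ j"
    have "\<sigma> i = \<sigma> j"
      using arg_cong[OF eq, of "\<lambda>u. u $ k"] assms(3) by (simp add: stack_nth axis_def)
    then show False using assms(5) that by (metis bij_betw_imp_inj_on injD)
  qed
  ultimately show ?thesis by (simp add: config_space_0_open[OF assms(2)])
qed

text \<open>Within a class, \<open>x\<close> and the stack have the same vertical order, which
  interpolation preserves. Between classes, the horizontal difference is only scaled by
  \<open>1 - t\<close>, since all points of the stack have the same horizontal part.\<close>

lemma homotopic_chart_stack:
  fixes \<Omega> :: "(real^'n) set" and \<sigma> :: "'l::finite \<Rightarrow> nat"
  assumes "open \<Omega>" "convex \<Omega>" "equiv UNIV E" "inj \<sigma>" "0 < s"
    and "stack c s k \<sigma> \<in> config_space 0 \<Omega>" "U \<subseteq> chart k E \<sigma> \<inter> config_space 0 \<Omega>"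
  shows "homotopic_with_canon (\<lambda>_. True) U (config_space 0 \<Omega>) id (\<lambda>_. stack c s k \<sigma>)"
proof (rule linear_homotopy_in_config_space[OF assms(1,2)])
  show "(1 - t) *\<^sub>R id x $ i + t *\<^sub>R stack c s k \<sigma> $ i \<noteq> (1 - t) *\<^sub>R id x $ j + t *\<^sub>R stack c s k \<sigma> $ j"
    if x: "x \<in> U" and t: "0 \<le> t" "t < 1" and "i \<noteq> j" for x t i j
  proof
    assume "(1 - t) *\<^sub>R id x $ i + t *\<^sub>R stack c s k \<sigma> $ i = (1 - t) *\<^sub>R id x $ j + t *\<^sub>R stack c s k \<sigma> $ j"
    then have eq: "(1 - t) *\<^sub>R x $ i + (t * (s * \<sigma> i)) *\<^sub>R axis k 1 =
        (1 - t) *\<^sub>R x $ j + (t * (s * \<sigma> j)) *\<^sub>R axis k 1"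
      by (simp add: stack_nth algebra_simps)
    have chart: "x \<in> chart k E \<sigma>" using x assms(7) by blast
    show False
    proof (cases "(i, j) \<in> E")
      case True
      have heights: "(1 - t) * x $ i $ k + t * (s * \<sigma> i) = (1 - t) * x $ j $ k + t * (s * \<sigma> j)"
        using arg_cong[OF eq, of "\<lambda>u. u $ k"] by (simp add: axis_def)
      have less: False if "\<sigma> a < \<sigma> b" "x $ a $ k < x $ b $ k"
        "(1 - t) * x $ a $ k + t * (s * \<sigma> a) = (1 - t) * x $ b $ k + t * (s * \<sigma> b)" for a b
      proof -
        have "(1 - t) * x $ a $ k < (1 - t) * x $ b $ k" using t that by simp
        moreover have "t * (s * \<sigma> a) \<le> t * (s * \<sigma> b)"
          using t that assms(5) by (intro mult_left_mono) auto
        ultimately show False using that by linarith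
      qed
      have "(j, i) \<in> E" using True assms(3) by (meson equivE symE)
      consider "\<sigma> i < \<sigma> j" | "\<sigma> j < \<sigma> i" using \<open>i \<noteq> j\<close> assms(4) by (metis injD linorder_neqE_nat)
      then show False
      proof cases
        case 1
        then show False using less[OF 1 _ heights] chart_height_iff[OF chart assms(3,4) True] by blast
      next
        case 2
        then show False
          using less[OF 2 _ heights[symmetric]] chart_height_iff[OF chart assms(3,4) \<open>(j, i) \<in> E\<close>] by blast
      qed
    next
      case False
      have h: "horizontal k ((1 - t) *\<^sub>R u + r *\<^sub>R axis k 1) = (1 - t) *\<^sub>R horizontal k u" for u r
        by (simp add: horizontal_def axis_def algebra_simps)
      have "(1 - t) *\<^sub>R horizontal k (x $ i) = (1 - t) *\<^sub>R horizontal k (x $ j)"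
        using arg_cong[OF eq, of "horizontal k"] unfolding h .
      then have "horizontal k (x $ i) = horizontal k (x $ j)" using t by simp
      \<comment> \<open>Comparing \<open>(i, i)\<close> in \<open>E\<close> with
        \<open>(i, j)\<close> outside \<open>E\<close> shows that the horizontal distance is
        positive.\<close>
      moreover have "(i, i) \<in> E" using assms(3) by (simp add: equiv_def refl_on_def)
      then have "dist (horizontal k (x $ i)) (horizontal k (x $ i)) <
          dist (horizontal k (x $ i)) (horizontal k (x $ j))"
        using chart False unfolding chart_def by blast
      ultimately show False by simp
    qed
  qed
qed (use assms in auto)

text \<open>The target stack is constant in coordinate \<open>k\<close>, so for \<open>t < 1\<close>
  this coordinate still separates the points. A second axis thus makes the final configuration
  independent of \<sigma>.\<close>

lemma homotopic_stack_stack: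
  fixes \<Omega> :: "(real^'n) set" and \<sigma> \<tau> :: "'l::finite \<Rightarrow> nat"
  assumes "open \<Omega>" "convex \<Omega>" "k \<noteq> k'" "inj \<sigma>" "0 < s"
    and "stack c s k \<sigma> \<in> config_space 0 \<Omega>" "stack c s k' \<tau> \<in> config_space 0 \<Omega>"
  shows "homotopic_with_canon (\<lambda>_. True) (U :: 'a::topological_space set) (config_space 0 \<Omega>)
           (\<lambda>_. stack c s k \<sigma>) (\<lambda>_. stack c s k' \<tau>)"
proof (rule linear_homotopy_in_config_space[OF assms(1,2)])
  show "(1 - t) *\<^sub>R stack c s k \<sigma> $ i + t *\<^sub>R stack c s k' \<tau> $ i \<noteq>
      (1 - t) *\<^sub>R stack c s k \<sigma> $ j + t *\<^sub>R stack c s k' \<tau> $ j"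
    if t: "0 \<le> t" "t < 1" and "i \<noteq> j" for t i j
  proof
    assume eq: "(1 - t) *\<^sub>R stack c s k \<sigma> $ i + t *\<^sub>R stack c s k' \<tau> $ i =
      (1 - t) *\<^sub>R stack c s k \<sigma> $ j + t *\<^sub>R stack c s k' \<tau> $ j"
    have "(1 - t) * (s * \<sigma> i) = (1 - t) * (s * \<sigma> j)"
      using arg_cong[OF eq, of "\<lambda>u. u $ k"] assms(3) by (simp add: stack_nth axis_def algebra_simps)
    then have "\<sigma> i = \<sigma> j" using t assms(5) by simp
    then show False using assms(4) \<open>i \<noteq> j\<close> by (meson injD)
  qed
qed (use assms in \<open>auto intro: continuous_intros\<close>)

section \<open>The cover by charts with a fixed number of classes\<close>

lemma LS_cat_le_CARD:
  fixes \<Omega> :: "(real^'n) set" and A :: "(real^'n^'l::finite) set"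
  assumes "open \<Omega>" "convex \<Omega>" "\<Omega> \<noteq> {}" "CARD('n) \<ge> 2" "A \<subseteq> config_space 0 \<Omega>"
  shows "LS_cat (top_of_set (config_space 0 \<Omega>)) A \<le> enat CARD('l)"
proof -
  define X where "X = (config_space 0 \<Omega> :: (real^'n^'l) set)"
  obtain c where "c \<in> \<Omega>" using assms(3) by blast
  then obtain \<delta> where \<delta>: "\<delta> > 0" "ball c \<delta> \<subseteq> \<Omega>" using assms(1) openE by blast
  define s where "s = \<delta> / CARD('l)"
  have s: "s > 0" "s * real CARD('l) \<le> \<delta>" using \<delta>(1) by (simp_all add: s_def)
  obtain k k' :: 'n where "k \<noteq> k'"
    using assms(4) by (metis card_2_iff' ex_card UNIV_I)
  obtain \<tau> :: "'l \<Rightarrow> nat" where \<tau>: "bij_betw \<tau> UNIV {0..<CARD('l)}"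
    using ex_bij_betw_finite_nat[of "UNIV :: 'l set"] by auto
  define a where "a = stack c s k' \<tau>"
  define \<V> where "\<V> p = {A \<inter> chart k E \<sigma> | E \<sigma>. equiv UNIV E \<and> card (UNIV // E) = p \<and>
      bij_betw \<sigma> UNIV {0..<CARD('l)}}" for p
  have X_stack: "stack c s m \<sigma> \<in> X" if "bij_betw \<sigma> UNIV {0..<CARD('l)}" for m \<sigma>
    unfolding X_def using stack_in_config_space \<delta>(2) assms(1) s that by blast
  \<comment> \<open>Different \<sigma> may define the same chart, so an overlap yields equality of
    the sets, not of the data.\<close>
  have disj: "V = V'" if V: "V \<in> \<V> p" "V' \<in> \<V> p" "V \<inter> V' \<noteq> {}" for V V' p
  proof -
    obtain E \<sigma> where 1: "V = A \<inter> chart k E \<sigma>" "equiv UNIV E" "card (UNIV // E) = p" "inj \<sigma>"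
      using V(1) unfolding \<V>_def bij_betw_def by blast
    obtain E' \<sigma>' where 2: "V' = A \<inter> chart k E' \<sigma>'" "equiv UNIV E'" "card (UNIV // E') = p" "inj \<sigma>'"
      using V(2) unfolding \<V>_def bij_betw_def by blast
    obtain x where "x \<in> chart k E \<sigma>" "x \<in> chart k E' \<sigma>'" using V(3) 1(1) 2(1) by blast
    then have "chart k E \<sigma> = (chart k E' \<sigma>' :: (real^'n^'l) set)"
      using 1(3) 2(3) by (intro chart_eqI[OF 1(2) 2(2) _ 1(4) 2(4)]) simp_all
    then show ?thesis by (simp only: 1(1) 2(1))
  qed
  have op: "openin (top_of_set A) V" if "V \<in> \<V> p" for V p
  proof -
    obtain E \<sigma> where "V = A \<inter> chart k E \<sigma>" using \<open>V \<in> \<V> p\<close> unfolding \<V>_def by blast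
    then show ?thesis using openin_open_Int[OF open_chart] by simp
  qed
  have contr: "contractible_in (top_of_set X) (\<Union>(\<V> p))" for p
  proof -
    have sub: "\<Union>(\<V> p) \<subseteq> A" unfolding \<V>_def by blast
    have "homotopic_with_canon (\<lambda>_. True) (\<Union>(\<V> p)) X id (\<lambda>_. a)"
    \<comment> \<open>The pieces are clopen in their union, so their homotopies glue freely,
      provided that all end at the same \<open>a\<close>.\<close>
    proof (rule homotopic_on_clopen_Union)
      show o: "openin (top_of_set (\<Union>(\<V> p))) V" if "V \<in> \<V> p" for V
        using openin_subset_trans[OF op[OF that] _ sub] that by blast
      show "closedin (top_of_set (\<Union>(\<V> p))) V" if "V \<in> \<V> p" for V
      proof -
        have "\<Union>(\<V> p) - V = \<Union>(\<V> p - {V})" using disj[OF that] by blast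
        then have "openin (top_of_set (\<Union>(\<V> p))) (\<Union>(\<V> p) - V)"
          using o by (metis Diff_iff openin_Union)
        then show ?thesis using that by (auto simp: closedin_def)
      qed
      show "homotopic_with_canon (\<lambda>_. True) V X id (\<lambda>_. a)" if V: "V \<in> \<V> p" for V
      proof -
        obtain E \<sigma> where *: "V = A \<inter> chart k E \<sigma>" "equiv UNIV E" "bij_betw \<sigma> UNIV {0..<CARD('l)}"
          using V unfolding \<V>_def by blast
        have "inj \<sigma>" using *(3) by (simp add: bij_betw_def)
        have "homotopic_with_canon (\<lambda>_. True) V X id (\<lambda>_. stack c s k \<sigma>)"
          unfolding X_def using *(1) assms(5)
          by (intro homotopic_chart_stack[OF assms(1,2) *(2) \<open>inj \<sigma>\<close> s(1)] X_stack[OF *(3), unfolded X_def]) blast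
        moreover have "homotopic_with_canon (\<lambda>_. True) V X (\<lambda>_. stack c s k \<sigma>) (\<lambda>_. a)"
          unfolding X_def a_def
          by (intro homotopic_stack_stack[OF assms(1,2) \<open>k \<noteq> k'\<close> \<open>inj \<sigma>\<close> s(1)]
              X_stack[OF *(3), unfolded X_def] X_stack[OF \<tau>, unfolded X_def])
        ultimately show ?thesis by (rule homotopic_with_trans)
      qed
    qed
    then show ?thesis
      using sub assms(5) unfolding contractible_in_def X_def
      by (auto simp: subtopology_subtopology Int_absorb1)
  qed
  define \<U> where "\<U> = (\<lambda>p. \<Union>(\<V> p)) ` {1..CARD('l)}"
  \<comment> \<open>Only an inequality, since sets for different \<open>p\<close> may coincide, for
    example when \<open>A\<close> is empty.\<close>
  have "finite \<U>" "card \<U> \<le> CARD('l)"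
    unfolding \<U>_def using card_image_le[of "{1..CARD('l)}" "\<lambda>p. \<Union>(\<V> p)"] by auto
  moreover have "\<Union>\<U> = A"
  proof
    show "\<Union>\<U> \<subseteq> A" unfolding \<U>_def \<V>_def by blast
    show "A \<subseteq> \<Union>\<U>"
    proof
      fix x assume "x \<in> A"
      then have distinct: "x $ i \<noteq> x $ j" if "i \<noteq> j" for i j
        using assms(5) that by (auto simp: config_space_0_open[OF assms(1)])
      obtain E \<sigma> where *: "equiv UNIV E" "bij_betw \<sigma> UNIV {0..<CARD('l)}" "x \<in> chart k E \<sigma>"
        using ex_chart[of x k, OF distinct] by blast
      let ?p = "card (UNIV // E)"
      have "UNIV // E = (\<lambda>i. E `` {i}) ` UNIV" by (auto simp: quotient_def)
      then have "?p \<in> {1..CARD('l)}"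
        using card_image_le[of "UNIV :: 'l set" "\<lambda>i. E `` {i}"] by (simp add: Suc_le_eq card_gt_0_iff)
      moreover have "x \<in> \<Union>(\<V> ?p)" unfolding \<V>_def using * \<open>x \<in> A\<close> by blast
      ultimately show "x \<in> \<Union>\<U>" unfolding \<U>_def by blast
    qed
  qed
  moreover have "openin (subtopology (top_of_set X) A) U \<and> contractible_in (top_of_set X) U"
    if "U \<in> \<U>" for U
    using that contr op assms(5) unfolding \<U>_def X_def
    by (auto simp: subtopology_subtopology Int_absorb1 intro!: openin_Union)
  ultimately have "LS_cat (top_of_set X) A \<le> enat (card \<U>)"
    unfolding LS_cat_def by (intro Inf_lower) blast
  also have "\<dots> \<le> enat CARD('l)" using \<open>card \<U> \<le> CARD('l)\<close> by simp
  finally show ?thesis by (simp add: X_def)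
qed

section \<open>The lower bound\<close>

text \<open>\<open>W\<close> retracts radially onto a product of spheres. \<open>G\<close> moves
  component \<open>i\<close> along \<open>h i\<close>, keeping its norm, and has bounded
  displacement, so it is surjective. A preimage of the point with components \<open>q i\<close> lies
  on the unit spheres, where some component of \<open>G\<close> is an endpoint
  \<open>h i (1, y)\<close>, which differs from \<open>q i\<close>.\<close>

lemma cover_essential_projections:
  fixes V :: "'l::finite \<Rightarrow> (real^'n^'l) set"
    and h :: "'l \<Rightarrow> real \<times> (real^'n^'l) \<Rightarrow> real^'n"
  defines "W \<equiv> {x :: real^'n^'l. \<forall>i. x $ i \<noteq> 0}"
  assumes V: "\<And>i. open (V i)" "(\<Union>i. V i) = W"
    and cont: "\<And>i. continuous_on ({0..1} \<times> V i) (h i)"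
    and sphere: "\<And>i t x. t \<in> {0..1} \<Longrightarrow> x \<in> V i \<Longrightarrow> norm (h i (t, x)) = 1"
    and h0: "\<And>i x. x \<in> V i \<Longrightarrow> h i (0, x) = sgn (x $ i)"
    and q: "\<And>i. norm (q i) = 1" "\<And>i x. x \<in> V i \<Longrightarrow> h i (1, x) \<noteq> q i"
  shows False
proof -
  \<comment> \<open>The quotients \<open>w i x / S x\<close> form a partition of unity on
    \<open>W\<close>, positive exactly on \<open>V i\<close>.\<close>
  define w where "w i x = infdist x (- V i)" for i and x :: "real^'n^'l"
  define S where "S x = (\<Sum>i\<in>UNIV. w i x)" for x
  \<comment> \<open>the time functions \<open>t i\<close> vanish unless all components of \<open>x\<close> are close to the unit sphere,
      and on the unit spheres at every point some \<open>t i\<close> equals \<open>1\<close>, so that \<open>G\<close> misses \<open>Q\<close>\<close>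
  define d where "d x = (\<Sum>j\<in>UNIV. \<bar>norm (x $ j) - 1\<bar>)" for x :: "real^'n^'l"
  define N where "N = real CARD('l)"
  define t where "t i x = max 0 (1 - 2 * d x) * max 0 (min 1 (2 * N * w i x / S x - 1))" for i x
  define G where "G x = (\<chi> i. if x \<in> V i then norm (x $ i) *\<^sub>R h i (t i x, x) else x $ i)" for x
  have N: "N > 0" by (simp add: N_def)
  have VW: "V i \<subseteq> W" for i using V by auto
  have "0 \<notin> W" by (simp add: W_def)
  \<comment> \<open>Excludes the default value 0 of \<open>infdist\<close> for the empty set, which
    would break \<open>w_pos\<close>.\<close>
  then have ne: "- V i \<noteq> {}" for i using VW by blast
  have w_pos: "w i x > 0" if "x \<in> V i" for i x
    using that V(1)[of i] in_closed_iff_infdist_zero[of "- V i" x] ne infdist_nonneg[of x "- V i"]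
    unfolding w_def by (force simp: closed_def)
  have w_nonneg: "w i x \<ge> 0" for i x by (simp add: w_def infdist_nonneg)
  have w_0: "w i x = 0" if "x \<notin> V i" for i x using that by (simp add: w_def)
  have S_pos: "S x > 0" if x: "x \<in> W" for x
  proof -
    obtain i where "x \<in> V i" using x V(2) by blast
    then show ?thesis unfolding S_def using w_pos w_nonneg by (intro sum_pos2[of _ i]) auto
  qed
  have w_cont [continuous_intros]: "continuous_on A (w i)" for A i
    unfolding w_def by (intro continuous_intros)
  have S_cont [continuous_intros]: "continuous_on A S" for A
    unfolding S_def by (intro continuous_intros)
  have d_cont [continuous_intros]: "continuous_on A d" for A
    unfolding d_def by (intro continuous_intros)
  have t01: "t i x \<in> {0..1}" for i x
  proof -
    have "d x \<ge> 0" by (simp add: d_def sum_nonneg)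
    then have "0 \<le> max 0 (1 - 2 * d x) \<and> max 0 (1 - 2 * d x) \<le> 1" by simp
    moreover have "0 \<le> max 0 (min 1 u) \<and> max 0 (min 1 u) \<le> 1" for u :: real by simp
    ultimately show ?thesis unfolding t_def atLeastAtMost_iff
      by (intro conjI mult_nonneg_nonneg mult_le_one) blast+
  qed
  have W_eq: "W = (\<Union>i. V i)" using V by simp
  have W_open: "open W" unfolding W_eq using V(1) by blast
  have d_le: "\<bar>norm (x $ i) - 1\<bar> \<le> d x" for x i
    unfolding d_def by (rule member_le_sum) auto
  have near: "x \<in> W" if "d x \<le> 1/2" for x
  proof -
    have "x $ i \<noteq> 0" for i using d_le[of x i] that by auto
    then show ?thesis by (simp add: W_def)
  qed
  have G_id: "G x $ i = x $ i" if "t i x = 0" for i x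
    using that h0[of x i] by (cases "x $ i = 0") (simp_all add: G_def sgn_div_norm)
  have norm_G: "norm (G x $ i) = norm (x $ i)" for i x
    using sphere[OF t01] by (simp add: G_def)
  have "continuous_on UNIV (\<lambda>x. G x $ i)" for i
  proof -
    \<comment> \<open>On \<open>O2\<close> and \<open>O3\<close> the time \<open>t i\<close>
      vanishes and component \<open>i\<close> stays fixed. \<open>O2\<close> contains the complement
      of \<open>W\<close>, and \<open>O3\<close> contains \<open>W\<close> minus \<open>V i\<close>,
      so with \<open>V i\<close> they form an open cover.\<close>
    define O2 where "O2 = {x. d x > 1/2}"
    define O3 where "O3 = W \<inter> {x. 2 * N * w i x < S x}"
    have op: "open O2" "open O3" "open (V i)"
      unfolding O2_def O3_def using W_open V(1)
      by (auto intro!: open_Collect_less continuous_intros open_Int)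
    have t_cont: "continuous_on (V i) (t i)"
      unfolding t_def using S_pos VW[of i] by (intro continuous_intros) force
    have c1: "continuous_on (V i) (\<lambda>x. G x $ i)"
    proof -
      have "continuous_on (V i) (\<lambda>x. h i (t i x, x))"
        by (rule continuous_on_compose2[OF cont[of i], of _ "\<lambda>x. (t i x, x)"])
          (use t01 in \<open>auto intro!: continuous_intros t_cont\<close>)
      then have "continuous_on (V i) (\<lambda>x. norm (x $ i) *\<^sub>R h i (t i x, x))"
        by (intro continuous_intros)
      then show ?thesis by (rule continuous_on_eq) (simp add: G_def)
    qed
    have c2: "continuous_on O2 (\<lambda>x. G x $ i)"
    proof (rule continuous_on_eq)
      show "continuous_on O2 (\<lambda>x. x $ i)" by (intro continuous_intros)
      show "x $ i = G x $ i" if "x \<in> O2" for x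
        using that by (simp add: G_id O2_def t_def)
    qed
    have c3: "continuous_on O3 (\<lambda>x. G x $ i)"
    proof (rule continuous_on_eq)
      show "continuous_on O3 (\<lambda>x. x $ i)" by (intro continuous_intros)
      show "x $ i = G x $ i" if "x \<in> O3" for x
      proof -
        have "2 * N * w i x / S x < 1" using that S_pos[of x] by (simp add: O3_def)
        then show ?thesis by (simp add: G_id t_def)
      qed
    qed
    have "x \<in> V i \<union> O2 \<union> O3" for x
      using near[of x] S_pos[of x] w_0[of x i] by (auto simp: O2_def O3_def not_less)
    then have "UNIV = V i \<union> O2 \<union> O3" by blast
    then show ?thesis
      using c1 c2 c3 op by (metis continuous_on_open_Un open_Un)
  qed
  then have "continuous_on UNIV (\<lambda>x. \<chi> i. G x $ i)" by (rule continuous_on_vec_lambda)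
  then have G_cont: "continuous_on A G" for A
    by (auto intro: continuous_on_subset)
  define Q where "Q = (\<chi> i. q i)"
  \<comment> \<open>Where \<open>G\<close> can differ from the identity, corresponding components of
    \<open>x\<close> and \<open>G x\<close> have norm at most 3/2, hence differ by at most
    3.\<close>
  have close: "norm (x - G x) \<le> 3 * N" for x
  proof (cases "d x \<le> 1/2")
    case True
    have "norm ((x - G x) $ i) \<le> 3" for i
    proof -
      have "norm ((x - G x) $ i) \<le> norm (x $ i) + norm (G x $ i)" 
        by (simp add: norm_triangle_ineq4)
      also have "\<dots> \<le> 3" using d_le[of x i] True by (simp add: norm_G)
      finally show ?thesis .
    qed
    then have "(\<Sum>i\<in>UNIV. norm ((x - G x) $ i)) \<le> (\<Sum>i\<in>(UNIV::'l set). 3)"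
      by (intro sum_mono) auto
    moreover have "norm (x - G x) \<le> (\<Sum>i\<in>UNIV. norm ((x - G x) $ i))"
      unfolding norm_vec_def by (rule L2_set_le_sum) auto
    ultimately show ?thesis by (simp add: N_def)
  next
    case False
    then have "G x = x" by (simp add: vec_eq_iff G_id t_def)
    then show ?thesis using N by simp
  qed
  \<comment> \<open>The map sending \<open>y\<close> to \<open>Q + (y - G y)\<close> preserves this
    ball, and its fixed points are preimages of \<open>Q\<close>.\<close>
  have "\<exists>y\<in>cball Q (3 * N). G y = Q"
    by (rule brouwer_surjective_cball[where S = "{Q}"])
      (use N G_cont close in \<open>auto simp: dist_norm norm_minus_commute\<close>)
  then obtain y where y: "G y = Q" by blast
  have y1: "norm (y $ i) = 1" for i
    using norm_G[of y i] q(1)[of i] by (simp add: y Q_def)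
  have "y $ i \<noteq> 0" for i
    using y1[of i] by auto
  then have "y \<in> W" by (simp add: W_def)
  \<comment> \<open>By averaging, some weight is at least \<open>1 / N\<close>, where the ramp in
    \<open>t i\<close> has reached 1.\<close>
  have "\<exists>i. S y \<le> N * w i y"
  proof (rule ccontr)
    assume "\<nexists>i. S y \<le> N * w i y"
    then have "(\<Sum>i\<in>UNIV. N * w i y) < (\<Sum>i\<in>(UNIV::'l set). S y)"
      by (intro sum_strict_mono) (auto simp: not_le)
    then show False by (simp add: S_def N_def flip: sum_distrib_left)
  qed
  then obtain i where i: "S y \<le> N * w i y" by blast
  have "y \<in> V i" using i w_0[of y i] S_pos[OF \<open>y \<in> W\<close>] by fastforce
  have "d y = 0" by (simp add: d_def y1)
  moreover have "2 * N * w i y / S y - 1 \<ge> 1"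
    using i S_pos[OF \<open>y \<in> W\<close>] by (simp add: field_simps)
  ultimately have "t i y = 1" by (simp add: t_def)
  then have "G y $ i = h i (1, y)" using \<open>y \<in> V i\<close> by (simp add: G_def y1)
  then show False using q(2)[OF \<open>y \<in> V i\<close>] by (simp add: y Q_def)
qed

section \<open>From a small categorical cover to null-homotopic projections\<close>

lemma LS_cat_ge_CARD:
  fixes A X :: "(real^'n^'l::finite) set"
  assumes "A \<subseteq> X"
    and distinct: "\<And>\<xi> i j. \<xi> \<in> X \<Longrightarrow> i \<noteq> j \<Longrightarrow> \<xi> $ i \<noteq> \<xi> $ j"
    and "inj R" "R i0 = 0"
    and spheres: "\<And>\<theta>. (\<And>i. norm (\<theta> i) = 1) \<Longrightarrow> (\<chi> i. c + R i *\<^sub>R \<theta> i) \<in> A"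
    and R_nonneg: "\<And>i. R i \<ge> (0::real)"
  shows "LS_cat (top_of_set X) A \<ge> enat CARD('l)"
  unfolding LS_cat_def
proof (rule Inf_greatest, clarify, rule ccontr)
  fix \<U> assume \<U>: "finite \<U>" "A = \<Union>\<U>"
    and open_contr: "\<forall>U\<in>\<U>. openin (subtopology (top_of_set X) (\<Union>\<U>)) U \<and> contractible_in (top_of_set X) U"
    and "\<not> enat CARD('l) \<le> enat (card \<U>)"
  \<comment> \<open>Fewer than \<open>CARD('l)\<close> sets can be labelled injectively by the
    indices other than \<open>i0\<close>.\<close>
  then have "card \<U> \<le> card (UNIV - {i0})" by simp
  then have "\<exists>g. g ` \<U> \<subseteq> UNIV - {i0} \<and> inj_on g \<U>"
    by (intro card_le_inj \<U>(1)) simp_all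
  then obtain g where g: "g ` \<U> \<subseteq> UNIV - {i0}" "inj_on g \<U>"
    by auto
  define W where "W = {x :: real^'n^'l. \<forall>i. x $ i \<noteq> 0}"
  \<comment> \<open>Normalising extends the map from the product of spheres to \<open>W\<close>.
    Component \<open>i0\<close> is a dummy factor, as \<open>R i0 = 0\<close>; it allows indexing by
    all of \<open>'l\<close>.\<close>
  define P where "P x = (\<chi> i. c + R i *\<^sub>R sgn (x $ i))" for x :: "real^'n^'l"
  have P_A: "P x \<in> A" if "x \<in> W" for x
    unfolding P_def using that by (intro spheres) (auto simp: W_def norm_sgn)
  have P_cont: "continuous_on W P"
    unfolding P_def sgn_div_norm by (intro continuous_intros) (auto simp: W_def)
  have "W = (\<Inter>i. {x. x $ i \<noteq> 0})" by (auto simp: W_def)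
  moreover have "open {x :: real^'n^'l. x $ i \<noteq> 0}" for i
    by (intro open_Collect_neq continuous_intros)
  ultimately have W_open: "open W" by (simp add: open_INT)
  define \<phi> where "\<phi> i \<xi> = sgn (\<xi> $ i - \<xi> $ i0)" for i and \<xi> :: "real^'n^'l"
  \<comment> \<open>Indices that label no set, among them \<open>i0\<close>, get the empty
    set.\<close>
  define V where "V i = {x \<in> W. i \<in> g ` \<U> \<and> P x \<in> inv_into \<U> g i}" for i
  define good where "good i h q \<longleftrightarrow> open (V i) \<and> continuous_on ({0..1} \<times> V i) h \<and>
      (\<forall>t\<in>{0..1}. \<forall>x\<in>V i. norm (h (t, x)) = 1) \<and> (\<forall>x\<in>V i. h (0, x) = sgn (x $ i)) \<and>
      norm q = 1 \<and> (\<forall>x\<in>V i. h (1, x) \<noteq> q)"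
    for i and h :: "real \<times> (real^'n^'l) \<Rightarrow> real^'n" and q
  have "\<exists>h q. good i h q" for i
  proof (cases "i \<in> g ` \<U>")
    case False
    have "good i (\<lambda>_. 0) (axis undefined 1)" using False by (auto simp: good_def V_def norm_axis_1)
    then show ?thesis by blast
  next
    case True
    define U where "U = inv_into \<U> g i"
    have "i \<noteq> i0" using True g by blast
    have "U \<in> \<U>" unfolding U_def using True by (rule inv_into_into)
    then have "openin (top_of_set A) U" "contractible_in (top_of_set X) U" "U \<subseteq> A"
      using open_contr \<U> \<open>A \<subseteq> X\<close> by (auto simp: subtopology_subtopology Int_absorb1)
    then have "U \<subseteq> X" using \<open>A \<subseteq> X\<close> by blast
    then obtain a where "homotopic_with_canon (\<lambda>_. True) U X id (\<lambda>_. a)"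
      using \<open>contractible_in (top_of_set X) U\<close>
      by (auto simp: contractible_in_def subtopology_subtopology Int_absorb1)
    then obtain H :: "real \<times> (real^'n^'l) \<Rightarrow> real^'n^'l" where H: "continuous_on ({0..1} \<times> U) H" "H \<in> ({0..1} \<times> U) \<rightarrow> X"
        "\<And>x. x \<in> U \<Longrightarrow> H (0, x) = x" "\<And>x. x \<in> U \<Longrightarrow> H (1, x) = a"
      unfolding homotopic_with_def by (auto simp: continuous_map_subtopology_eu)
    have V_eq: "V i = {x \<in> W. P x \<in> U}" using True by (simp add: V_def U_def)
    obtain T where T: "open T" "U = A \<inter> T" using \<open>openin (top_of_set A) U\<close> by (auto simp: openin_open)
    have "V i = W \<inter> P -` T" unfolding V_eq using T P_A by auto
    then have V_open: "open (V i)" using P_cont T(1) W_open by (simp add: continuous_open_preimage)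
    \<comment> \<open>Contract the configuration \<open>P x\<close> and read off the direction from
      point \<open>i0\<close> to point \<open>i\<close>. It never degenerates, because
      \<open>H\<close> stays in \<open>X\<close>, where points are distinct.\<close>
    define h where "h tx = \<phi> i (H (fst tx, P (snd tx)))" for tx
    have ne: "\<xi> $ i - \<xi> $ i0 \<noteq> 0" if "\<xi> \<in> X" for \<xi>
      using distinct[OF that \<open>i \<noteq> i0\<close>] by simp
    have HX: "H (t, P x) \<in> X" if "t \<in> {0..1}" "x \<in> V i" for t x
      using that H(2) by (auto simp: V_eq)
    have "continuous_on ({0..1} \<times> V i) (\<lambda>tx. H (fst tx, P (snd tx)))"
      by (rule continuous_on_compose2[OF H(1)])
        (auto simp: V_eq intro!: continuous_intros continuous_on_compose2[OF P_cont])
    then have h_cont: "continuous_on ({0..1} \<times> V i) h"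
      unfolding h_def \<phi>_def using ne HX
      by (intro continuous_on_sgn continuous_intros) auto
    have h_norm: "norm (h (t, x)) = 1" if "t \<in> {0..1}" "x \<in> V i" for t x
      using ne[OF HX[OF that]] by (simp add: h_def \<phi>_def norm_sgn)
    have h_0: "h (0, x) = sgn (x $ i)" if "x \<in> V i" for x
    proof -
      have "R i \<noteq> 0" using \<open>inj R\<close> \<open>R i0 = 0\<close> \<open>i \<noteq> i0\<close> by (metis injD)
      then have "R i > 0" using R_nonneg[of i] by simp
      then have "sgn (P x $ i - P x $ i0) = sgn (x $ i)"
        by (cases "x $ i = 0") (simp_all add: P_def \<open>R i0 = 0\<close> sgn_scaleR norm_sgn sgn_div_norm[of "sgn _"])
      then show ?thesis using that H(3) by (simp add: V_eq h_def \<phi>_def)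
    qed
    have "\<exists>q :: real^'n. norm q = 1 \<and> (\<forall>x\<in>V i. h (1, x) \<noteq> q)"
    \<comment> \<open>At time 1 the direction is the constant \<open>\<phi> i a\<close>, so its
      antipode is missed. Membership of \<open>a\<close> in \<open>X\<close> is only derived from a
      point of \<open>V i\<close>, so the empty case is separate.\<close>
    proof (cases "V i = {}")
      case True
      have "norm (axis undefined 1 :: real^'n) = 1" by (simp add: norm_axis_1)
      then show ?thesis using True by blast
    next
      case False
      then obtain y where "y \<in> V i" by blast
      then have "a \<in> X" using H(4)[of "P y"] HX[of 1 y] by (simp add: V_eq)
      then have "norm (- \<phi> i a) = 1" using ne by (simp add: \<phi>_def norm_sgn)
      moreover from this have "\<phi> i a \<noteq> - \<phi> i a"
        by (auto simp: eq_neg_iff_add_eq_0 simp flip: scaleR_2)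
      moreover have "h (1, x) = \<phi> i a" if "x \<in> V i" for x
        using that H(4) by (simp add: h_def V_eq)
      ultimately show ?thesis by metis
    qed
    then obtain q :: "real^'n" where "norm q = 1" "\<forall>x\<in>V i. h (1, x) \<noteq> q" by blast
    then have "good i h q" using V_open h_cont h_norm h_0 by (simp add: good_def)
    then show ?thesis by blast
  qed
  then obtain h q where good: "\<And>i. good i (h i) (q i)" by metis
  have "(\<Union>i. V i) = W"
  proof
    show "(\<Union>i. V i) \<subseteq> W" by (auto simp: V_def)
    show "W \<subseteq> (\<Union>i. V i)"
    proof
      fix x assume "x \<in> W"
      then obtain U where "U \<in> \<U>" "P x \<in> U" using P_A \<U>(2) by blast
      then have "x \<in> V (g U)" using \<open>x \<in> W\<close> g(2) by (simp add: V_def)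
      then show "x \<in> (\<Union>i. V i)" by blast
    qed
  qed
  then show False
    using good by (intro cover_essential_projections[of V h q]) (auto simp: good_def W_def)
qed

section \<open>Concentric spheres inside the domain\<close>

lemma config_space_subset:
  fixes \<Omega> \<Theta> :: "(real^'n) set"
  assumes "0 \<le> r" "open \<Theta>" "\<Omega> \<subseteq> \<Theta>"
  shows "(config_space r \<Omega> :: (real^'n^'l) set) \<subseteq> config_space 0 \<Theta>"
proof
  fix \<xi> :: "real^'n^'l" assume *: "\<xi> \<in> config_space r \<Omega>"
  have "\<xi> $ i \<noteq> \<xi> $ j" if "i \<noteq> j" for i j
  proof -
    have "norm (\<xi> $ i - \<xi> $ j) > 2 * r" using * that by (simp add: config_space_def)
    then show ?thesis using assms(1) by auto
  qed
  moreover have "\<xi> $ i \<in> \<Theta>" for i using * assms(3) by (auto simp: config_space_def)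
  ultimately show "\<xi> \<in> config_space 0 \<Theta>" by (simp add: config_space_0_open[OF assms(2)])
qed

text \<open>Points on spheres around \<open>c\<close> whose radii differ by at least
  \<open>s\<close> stay at least \<open>s\<close> apart. The threshold for \<open>r\<close> depends
  only on \<Omega>, so \<Theta> is quantified inside and may vary with \<open>r\<close>.\<close>

lemma LS_cat_config_space_ge:
  fixes \<Omega> :: "(real^'n) set"
  assumes "open \<Omega>" "\<Omega> \<noteq> {}"
  shows "\<forall>\<^sub>F r in at_right 0. \<forall>\<Theta>. open \<Theta> \<longrightarrow> \<Omega> \<subseteq> \<Theta> \<longrightarrow>
    LS_cat (top_of_set (config_space 0 \<Theta>)) (config_space r \<Omega> :: (real^'n^'l::finite) set) \<ge> enat CARD('l)"
proof -
  obtain c where "c \<in> \<Omega>" using assms(2) by blast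
  then obtain \<delta> where \<delta>: "\<delta> > 0" "ball c \<delta> \<subseteq> \<Omega>" using assms(1) openE by blast
  \<comment> \<open>The factor 2 keeps all radii below \<open>\<delta> / 2\<close>, leaving a margin
    of at least \<open>\<delta> / 2\<close> to the complement.\<close>
  define s where "s = \<delta> / (2 * CARD('l))"
  have s: "s > 0" "s * real CARD('l) = \<delta> / 2" using \<delta>(1) by (simp_all add: s_def)
  obtain \<tau> :: "'l \<Rightarrow> nat" where \<tau>: "bij_betw \<tau> UNIV {0..<CARD('l)}"
    using ex_bij_betw_finite_nat[of "UNIV :: 'l set"] by auto
  define R where "R i = s * real (\<tau> i)" for i
  have "inj \<tau>" using \<tau> by (simp add: bij_betw_def)
  then have "inj R" using s(1) by (auto simp: R_def inj_def)
  have "0 \<in> range \<tau>" using bij_betw_imp_surj_on[OF \<tau>] by simp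
  then obtain i0 where i0: "R i0 = 0" by (force simp: R_def)
  have R_nonneg: "R i \<ge> 0" for i using s(1) by (simp add: R_def)
  have R_le: "R i \<le> \<delta> / 2" for i
  proof -
    have "\<tau> i < CARD('l)" using bij_betwE[OF \<tau>] by simp
    then have "R i \<le> s * real CARD('l)" unfolding R_def using s(1) by (intro mult_left_mono) auto
    then show ?thesis by (simp add: s(2))
  qed
  have R_sep: "\<bar>R i - R j\<bar> \<ge> s" if "i \<noteq> j" for i j
  proof -
    have "\<tau> i \<noteq> \<tau> j" using \<open>inj \<tau>\<close> that by (meson injD)
    then have "1 \<le> \<bar>real (\<tau> i) - real (\<tau> j)\<bar>" by linarith
    then have "s * 1 \<le> s * \<bar>real (\<tau> i) - real (\<tau> j)\<bar>" using s(1) by (intro mult_left_mono) auto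
    also have "\<dots> = \<bar>R i - R j\<bar>" using s(1) by (simp add: R_def abs_mult flip: right_diff_distrib)
    finally show ?thesis by simp
  qed
  have key: "LS_cat (top_of_set (config_space 0 \<Theta>)) (config_space r \<Omega> :: (real^'n^'l) set) \<ge> enat CARD('l)"
    if r: "0 < r" "r < min (\<delta> / 2) (s / 2)" and \<Theta>: "open \<Theta>" "\<Omega> \<subseteq> \<Theta>" for r \<Theta>
  proof (rule LS_cat_ge_CARD[OF _ _ \<open>inj R\<close> i0 _ R_nonneg])
    show "config_space r \<Omega> \<subseteq> config_space 0 \<Theta>" using r(1) \<Theta> by (intro config_space_subset) auto
    show "\<xi> $ i \<noteq> \<xi> $ j" if "\<xi> \<in> config_space 0 \<Theta>" "i \<noteq> j" for \<xi> :: "real^'n^'l" and i j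
      using that by (simp add: config_space_0_open[OF \<Theta>(1)])
    fix \<theta> :: "'l \<Rightarrow> real^'n" assume \<theta>: "\<And>i. norm (\<theta> i) = 1"
    have norm_R: "norm (R i *\<^sub>R \<theta> i) = R i" for i by (simp add: \<theta> R_nonneg)
    have "c + R i *\<^sub>R \<theta> i \<in> \<Omega>" for i
    proof -
      have "dist c (c + R i *\<^sub>R \<theta> i) < \<delta>" using R_le[of i] \<delta>(1) norm_R[of i] by (simp add: dist_norm)
      then show ?thesis using \<delta>(2) by auto
    qed
    moreover have "infdist (c + R i *\<^sub>R \<theta> i) (- \<Omega>) > r" if ne: "- \<Omega> \<noteq> {}" for i
    proof -
      have "\<delta> / 2 \<le> dist (c + R i *\<^sub>R \<theta> i) y" if "y \<in> - \<Omega>" for y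
      proof -
        have "\<delta> \<le> dist c y" using that \<delta>(2) by (meson ComplD in_mono linorder_not_less mem_ball)
        also have "\<dots> \<le> dist c (c + R i *\<^sub>R \<theta> i) + dist (c + R i *\<^sub>R \<theta> i) y" by (rule dist_triangle)
        also have "dist c (c + R i *\<^sub>R \<theta> i) = R i" using norm_R[of i] by (simp add: dist_norm)
        finally show ?thesis using R_le[of i] by linarith
      qed
      then have "\<delta> / 2 \<le> infdist (c + R i *\<^sub>R \<theta> i) (- \<Omega>)"
        unfolding infdist_notempty[OF ne] using ne by (intro cINF_greatest) auto
      then show ?thesis using r by simp
    qed
    moreover have "norm (c + R i *\<^sub>R \<theta> i - (c + R j *\<^sub>R \<theta> j)) > 2 * r" if "i \<noteq> j" for i j
    proof -
      have "2 * r < s" using r by simp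
      also have "s \<le> \<bar>R i - R j\<bar>" using R_sep[OF that] .
      also have "\<dots> \<le> norm (R i *\<^sub>R \<theta> i - R j *\<^sub>R \<theta> j)"
        using norm_triangle_ineq3[of "R i *\<^sub>R \<theta> i" "R j *\<^sub>R \<theta> j"] unfolding norm_R .
      finally show ?thesis by simp
    qed
    ultimately show "(\<chi> i. c + R i *\<^sub>R \<theta> i) \<in> config_space r \<Omega>"
      unfolding config_space_def by auto
  qed
  have "0 < min (\<delta> / 2) (s / 2)" using \<delta>(1) s(1) by simp
  then have "\<forall>\<^sub>F r in at_right 0. r \<in> {0<..<min (\<delta> / 2) (s / 2)}" by (rule eventually_at_right_real)
  then show ?thesis by (rule eventually_mono) (use key in auto)
qed

theorem theorem1p3:
  fixes \<Omega> :: "(real^'n) set"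
  assumes "CARD('n) \<ge> 2"
    and "CARD('l::finite) \<ge> 2"
    and "bounded_smooth_domain \<Omega>"
  shows "(\<forall>\<^sub>F r in at_right 0.
            LS_cat (top_of_set (config_space 0 (outer_nbhd r \<Omega>)))
              (config_space r \<Omega> :: (real^'n^'l) set) \<ge> enat CARD('l)) \<and>
         (convex \<Omega> \<longrightarrow>
           (\<forall>\<^sub>F r in at_right 0.
            LS_cat (top_of_set (config_space 0 \<Omega>))
              (config_space r \<Omega> :: (real^'n^'l) set) = enat CARD('l)))"
proof -
  have \<Omega>: "open \<Omega>" "\<Omega> \<noteq> {}" using assms(3) by (simp_all add: bounded_smooth_domain_def)
  have nbhd: "open (outer_nbhd r \<Omega>)" "r > 0 \<Longrightarrow> \<Omega> \<subseteq> outer_nbhd r \<Omega>" for r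
    using \<Omega>(2) by (auto simp: outer_nbhd_def intro!: open_Collect_less continuous_intros)
  \<comment> \<open>Positivity of \<open>r\<close> is recorded because it places \<Omega> inside
    \<open>outer_nbhd r \<Omega>\<close> and gives the inclusion of configuration spaces.\<close>
  note ev = eventually_conj[OF LS_cat_config_space_ge[OF \<Omega>, where 'l = 'l] eventually_at_right_less]
  have "\<forall>\<^sub>F r in at_right 0.
      LS_cat (top_of_set (config_space 0 (outer_nbhd r \<Omega>)))
        (config_space r \<Omega> :: (real^'n^'l) set) \<ge> enat CARD('l)"
    using ev by (rule eventually_mono) (use nbhd in blast)
  moreover have "\<forall>\<^sub>F r in at_right 0.
      LS_cat (top_of_set (config_space 0 \<Omega>)) (config_space r \<Omega> :: (real^'n^'l) set) = enat CARD('l)"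
    if "convex \<Omega>"
    using ev
  proof (rule eventually_mono)
    fix r :: real
    assume r: "(\<forall>\<Theta>. open \<Theta> \<longrightarrow> \<Omega> \<subseteq> \<Theta> \<longrightarrow>
        LS_cat (top_of_set (config_space 0 \<Theta>)) (config_space r \<Omega> :: (real^'n^'l) set) \<ge> enat CARD('l)) \<and> 0 < r"
    then have sub: "(config_space r \<Omega> :: (real^'n^'l) set) \<subseteq> config_space 0 \<Omega>"
      using config_space_subset[of r \<Omega> \<Omega>] \<Omega>(1) by simp
    show "LS_cat (top_of_set (config_space 0 \<Omega>)) (config_space r \<Omega> :: (real^'n^'l) set) = enat CARD('l)"
    proof (rule antisym)
      show "LS_cat (top_of_set (config_space 0 \<Omega>)) (config_space r \<Omega> :: (real^'n^'l) set) \<le> enat CARD('l)"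
        by (rule LS_cat_le_CARD[OF \<Omega>(1) that \<Omega>(2) assms(1) sub])
    qed (use r \<Omega>(1) in blast)
  qed
  ultimately show ?thesis by blast
qed

end
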